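(* Let $p$ be an odd prime and let $A_p$ be the real symmetric $(p-1)\times(p-1)$ matrix all of whose diagonal entries equal $\frac{p-1}{2}$ and all of whose off-diagonal entries equal $-\frac12$. Let $\Lambda_p\subset\mathbb{E}^{p-1}$ be the lattice corresponding to the quadratic form $A_p$ (equivalently, the image of $\mathbb{Z}[\zeta]$, $\zeta=\exp(2\pi i/p)$, under the Minkowski embedding). Then $\Theta_{1,1;\Lambda_p}=0$.
   Context: $\mathbb{E}^n$ is Euclidean $n$-space. The lattice corresponding to a positive definite symmetric real matrix $A$ is generated by the columns of a real matrix $Q$ with $A={}^tQQ$; it is unique up to $\mathrm{O}(n)$. For a lattice $\Lambda\subset\mathbb{E}^n$ of rank $n$, the holomorphic function $\Theta_{1,1;\Lambda}$ on the upper half plane is $$\Theta_{1,1;\Lambda}(z)=\sum_{(\gamma,\delta)\in\Lambda\times\Lambda}\left(\frac12\langle\gamma,\delta\rangle^2-\frac1{2n}\|\gamma\|^2\|\delta\|^2\right)\exp\bigl(2\pi i(\|\gamma\|^2+\|\delta\|^2)z\bigr),$$ which is invariant under $\mathrm{O}(n)$. The Minkowski embedding is $\iota:\mathbb{Z}[\zeta]\to\mathbb{C}^{(p-1)/2}$, the additive map with $\zeta^k\mapsto(\zeta^k,\zeta^{2k},\dots,\zeta^{\frac{p-1}{2}k})$, where $\mathbb{C}^{(p-1)/2}$ is identified with $\mathbb{E}^{p-1}$ via the scalar product $\langle z,z'\rangle=\frac12\sum_i(z_i\overline{z_i'}+\overline{z_i}z_i')$. *)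

theory Defs
  imports "HOL-Analysis.Analysis" "HOL-Computational_Algebra.Polynomial" "HOL-Computational_Algebra.Primes"
begin

definition column_lattice :: "real^'n^'n \<Rightarrow> (real^'n) set" where
  "column_lattice Q = range (\<lambda>c :: 'n \<Rightarrow> int. \<Sum>j\<in>UNIV. of_int (c j) *\<^sub>R column j Q)"

text \<open>The lattice corresponding to a positive definite \<open>A\<close> is unique only up to the orthogonal
  group, so it is a relation here. If \<open>A\<close> is positive definite, then every such \<open>Q\<close> is
  invertible and the lattice has full rank.\<close>

definition corresponds_to_form :: "(real^'n) set \<Rightarrow> real^'n^'n \<Rightarrow> bool" where
  "corresponds_to_form \<Lambda> A \<longleftrightarrow> (\<exists>Q. A = transpose Q ** Q \<and> \<Lambda> = column_lattice Q)"

definition A_mat :: "nat \<Rightarrow> real^'n^'n" where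
  "A_mat p = (\<chi> i j. if i = j then (real p - 1) / 2 else - 1 / 2)"

definition theta11_term :: "complex \<Rightarrow> (real^'n) \<times> (real^'n) \<Rightarrow> complex" where
  "theta11_term z = (\<lambda>(\<gamma>, \<delta>).
     complex_of_real (1 / 2 * (\<gamma> \<bullet> \<delta>)\<^sup>2 - 1 / (2 * real CARD('n)) * (norm \<gamma>)\<^sup>2 * (norm \<delta>)\<^sup>2)
     * exp (2 * complex_of_real pi * \<i> * complex_of_real ((norm \<gamma>)\<^sup>2 + (norm \<delta>)\<^sup>2) * z))"

definition Theta11 :: "(real^'n) set \<Rightarrow> complex \<Rightarrow> complex" where
  "Theta11 \<Lambda> z = (\<Sum>\<^sub>\<infinity>w\<in>\<Lambda> \<times> \<Lambda>. theta11_term z w)"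

definition zeta :: "nat \<Rightarrow> complex" where
  "zeta p = exp (2 * complex_of_real pi * \<i> / of_nat p)"

definition int_adjoin :: "complex \<Rightarrow> complex set" where
  "int_adjoin x = range (\<lambda>q :: int poly. poly (map_poly of_int q) x)"

text \<open>The coordinates \<open>1, \<dots>, (p - 1) / 2\<close> are labelled by the type \<open>'m\<close>
  through a bijection \<open>idx\<close>. The conditions determine \<open>\<iota>\<close> on \<open>int_adjoin (zeta p)\<close>;
  its values elsewhere are irrelevant.\<close>

definition minkowski_embedding ::
  "nat \<Rightarrow> ('m::finite \<Rightarrow> nat) \<Rightarrow> (complex \<Rightarrow> complex^'m) \<Rightarrow> bool" where
  "minkowski_embedding p idx \<iota> \<longleftrightarrow>
     bij_betw idx UNIV {1..(p - 1) div 2} \<and>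
     (\<forall>x\<in>int_adjoin (zeta p). \<forall>y\<in>int_adjoin (zeta p). \<iota> (x + y) = \<iota> x + \<iota> y) \<and>
     (\<forall>k::nat. \<iota> (zeta p ^ k) = (\<chi> i. zeta p ^ (idx i * k)))"

definition minkowski_product :: "complex^'m \<Rightarrow> complex^'m \<Rightarrow> complex" where
  "minkowski_product z z' = 1 / 2 * (\<Sum>i\<in>UNIV. z $ i * cnj (z' $ i) + cnj (z $ i) * z' $ i)"

definition euclidean_identification :: "(complex^'m \<Rightarrow> real^'n) \<Rightarrow> bool" where
  "euclidean_identification f \<longleftrightarrow>
     linear f \<and> bij f \<and> (\<forall>z z'. complex_of_real (f z \<bullet> f z') = minkowski_product z z')"

end

theory Submission imports Defs begin

text \<open>Write \<open>n = p - 1\<close>. Given a lattice with Gram matrix \<open>A_mat p\<close> and basis \<open>q\<^sub>1, \<dots>, q\<^sub>n\<close>, put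
  \<open>q\<^sub>0 = - (q\<^sub>1 + \<dots> + q\<^sub>n)\<close>. Then \<open>q\<^sub>0, \<dots>, q\<^sub>n\<close> are the vertices of a regular simplex, and the symmetric
  group permuting them acts on the lattice by isometries. It acts irreducibly on the space, so
  for a rapidly decreasing weight \<open>w\<close> that depends on the norm only, the form
  \<open>M(u, v) = \<Sum> \<langle>\<gamma>, u\<rangle> \<langle>\<gamma>, v\<rangle> w(\<gamma>)\<close>, summed over the lattice, is a multiple of the inner product.
  Comparing traces, \<open>\<Sum> (\<langle>\<gamma>, \<delta>\<rangle>\<^sup>2 - \<parallel>\<gamma>\<parallel>\<^sup>2 \<parallel>\<delta>\<parallel>\<^sup>2 / n) w(\<gamma>) = 0\<close> for every vector \<open>\<delta>\<close>
  (\<open>weighted_second_moment\<close>). With \<open>w(\<gamma>) = exp (2 \<pi> i \<parallel>\<gamma>\<parallel>\<^sup>2 z)\<close> this is, up to the factor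
  \<open>w(\<delta>) / 2\<close>, the inner sum of the theta series, which therefore vanishes (\<open>theta11_int_span\<close>).

  Only the transpositions of \<open>q\<^sub>a\<close> and \<open>q\<^sub>0\<close> are needed. They are the reflections in
  \<open>r\<^sub>a = q\<^sub>a - q\<^sub>0\<close>; the \<open>r\<^sub>a\<close> span the space and no two of them are orthogonal, which replaces
  representation theory by the eigenvector argument of \<open>invariant_form_scalar\<close>.

  For the second description of the lattice, orthogonality of characters shows that the images
  of \<open>1, \<zeta>, \<dots>, \<zeta>\<^bsup>p - 2\<^esup>\<close> under the Minkowski embedding have Gram matrix \<open>A_mat p\<close> as well
  (\<open>simplex_frame_minkowski_embedding\<close>), and these powers generate the cyclotomic integers
  additively (\<open>int_adjoin_zeta\<close>). Two bases with the same Gram matrix differ by an isometry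
  (\<open>isometry_of_simplex_frames\<close>), which is the required identification of the two Euclidean spaces.\<close>

section \<open>Simplex frames\<close>

text \<open>Together with \<open>- (\<Sum>j. q j)\<close>, such vectors are the \<open>CARD('n) + 1\<close> vertices of a regular
  simplex centred at the origin. Up to isometry they are determined by their Gram matrix, which is
  \<open>A_mat p\<close> for \<open>p = CARD('n) + 1\<close>. The ambient space is left open because both \<open>real^'n\<close> and
  \<open>complex^'m\<close> will carry such frames.\<close>

definition simplex_frame :: "('n::finite \<Rightarrow> 'a::real_inner) \<Rightarrow> bool" where
  "simplex_frame q \<longleftrightarrow>
     (\<forall>i j. q i \<bullet> q j = (if i = j then real CARD('n) / 2 else - 1 / 2))"

definition int_span :: "('n::finite \<Rightarrow> 'a::real_vector) \<Rightarrow> 'a set" where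
  "int_span q = range (\<lambda>c :: 'n \<Rightarrow> int. \<Sum>j\<in>UNIV. of_int (c j) *\<^sub>R q j)"

lemma simplex_frame_inner:
  fixes q :: "'n::finite \<Rightarrow> 'a::real_inner"
  assumes "simplex_frame q"
  shows "q i \<bullet> q j = (real CARD('n) + 1) / 2 * of_bool (i = j) - 1 / 2"
  using assms by (simp add: simplex_frame_def field_simps)

lemma inner_combination_frame:
  fixes q :: "'n::finite \<Rightarrow> 'a::real_inner"
  assumes "simplex_frame q"
  shows "(\<Sum>i\<in>UNIV. x i *\<^sub>R q i) \<bullet> q j
    = (real CARD('n) + 1) / 2 * x j - (\<Sum>i\<in>UNIV. x i) / 2"
proof -
  have "(\<Sum>i\<in>UNIV. x i *\<^sub>R q i) \<bullet> q j
    = (\<Sum>i\<in>UNIV. (real CARD('n) + 1) / 2 * (if i = j then x i else 0) - x i / 2)"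
    by (auto simp: inner_sum_left simplex_frame_inner[OF assms] field_simps intro!: sum.cong)
  then show ?thesis
    by (simp add: sum_subtractf sum.delta flip: sum_distrib_left sum_divide_distrib)
qed

lemma inner_combinations:
  fixes q :: "'n::finite \<Rightarrow> 'a::real_inner"
  assumes "simplex_frame q"
  shows "(\<Sum>i\<in>UNIV. x i *\<^sub>R q i) \<bullet> (\<Sum>j\<in>UNIV. y j *\<^sub>R q j)
    = (real CARD('n) + 1) / 2 * (\<Sum>j\<in>UNIV. x j * y j)
      - (\<Sum>i\<in>UNIV. x i) * (\<Sum>j\<in>UNIV. y j) / 2"
proof -
  have "(\<Sum>i\<in>UNIV. x i *\<^sub>R q i) \<bullet> (\<Sum>j\<in>UNIV. y j *\<^sub>R q j)
    = (\<Sum>j\<in>UNIV. y j * ((real CARD('n) + 1) / 2 * x j - (\<Sum>i\<in>UNIV. x i) / 2))"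
    by (simp only: inner_sum_right inner_scaleR_right inner_combination_frame[OF assms])
  also have "\<dots> = (real CARD('n) + 1) / 2 * (\<Sum>j\<in>UNIV. x j * y j)
      - (\<Sum>i\<in>UNIV. x i) * (\<Sum>j\<in>UNIV. y j) / 2"
    by (simp add: algebra_simps sum_subtractf sum.distrib sum_distrib_left sum_distrib_right
        flip: sum_divide_distrib)
  finally show ?thesis .
qed

text \<open>The smallest eigenvalue of the Gram matrix \<open>(p I - J) / 2\<close> is \<open>1 / 2\<close>, attained at the all-ones
  vector. This bound gives linear independence of the frame and, later, Gaussian domination of
  the theta series.\<close>

lemma norm_combination_ge:
  fixes q :: "'n::finite \<Rightarrow> 'a::real_inner"
  assumes "simplex_frame q"
  shows "(\<Sum>i\<in>UNIV. (x i)\<^sup>2) / 2 \<le> (norm (\<Sum>i\<in>UNIV. x i *\<^sub>R q i))\<^sup>2"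
proof -
  have "(norm (\<Sum>i\<in>UNIV. x i *\<^sub>R q i))\<^sup>2
    = (real CARD('n) + 1) / 2 * (\<Sum>i\<in>UNIV. (x i)\<^sup>2) - (\<Sum>i\<in>UNIV. x i)\<^sup>2 / 2"
    unfolding power2_norm_eq_inner inner_combinations[OF assms] by (simp add: power2_eq_square)
  moreover have "(\<Sum>i\<in>UNIV. x i)\<^sup>2 \<le> (\<Sum>i\<in>UNIV. (x i)\<^sup>2) * CARD('n)"
    by (rule sum_squared_le_sum_of_squares)
  ultimately show ?thesis by (simp add: field_simps)
qed

lemma bij_combination:
  fixes q :: "'n::finite \<Rightarrow> 'a::euclidean_space"
  assumes "simplex_frame q" and "DIM('a) = CARD('n)"
  shows "bij (\<lambda>x :: real^'n. \<Sum>i\<in>UNIV. x $ i *\<^sub>R q i)"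
proof -
  let ?S = "\<lambda>x :: real^'n. \<Sum>i\<in>UNIV. x $ i *\<^sub>R q i"
  have lin: "linear ?S"
    by (rule linearI) (simp_all add: scaleR_add_left sum.distrib scaleR_sum_right)
  have "inj ?S"
  proof (subst linear_injective_0[OF lin], intro allI impI)
    fix x :: "real^'n" assume "?S x = 0"
    with norm_combination_ge[OF assms(1), of "($) x"] have "(\<Sum>i\<in>UNIV. (x $ i)\<^sup>2) \<le> 0"
      by simp
    then have "(\<Sum>i\<in>UNIV. (x $ i)\<^sup>2) = 0" by (simp add: antisym sum_nonneg)
    then show "x = 0" by (simp add: sum_nonneg_eq_0_iff vec_eq_iff)
  qed
  moreover from this have "dim (range ?S) = DIM('a)"
    using dim_image_eq[OF lin] assms(2) by (simp add: dim_UNIV)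
  then have "surj ?S"
    using dim_eq_full[of "range ?S"] linear_subspace_image[OF lin subspace_UNIV]
    by (metis span_eq_iff)
  ultimately show ?thesis by (simp add: bij_def)
qed

lemma span_simplex_frame:
  fixes q :: "'n::finite \<Rightarrow> 'a::euclidean_space"
  assumes "simplex_frame q" and "DIM('a) = CARD('n)"
  shows "span (range q) = UNIV"
proof -
  have "v \<in> span (range q)" for v
  proof -
    obtain x :: "real^'n" where "v = (\<Sum>i\<in>UNIV. x $ i *\<^sub>R q i)"
      using bij_is_surj[OF bij_combination[OF assms]] by (blast elim: surjE)
    then show ?thesis by (auto intro!: span_sum span_scale intro: span_base)
  qed
  then show ?thesis by auto
qed

section \<open>Integer spans\<close>

lemma int_spanI: "(\<Sum>j\<in>UNIV. of_int (c j) *\<^sub>R q j) \<in> int_span q"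
  unfolding int_span_def by (rule rangeI)

lemma int_span_add: "u \<in> int_span q \<Longrightarrow> v \<in> int_span q \<Longrightarrow> u + v \<in> int_span q"
proof -
  assume "u \<in> int_span q" "v \<in> int_span q"
  then obtain c d where "u = (\<Sum>j\<in>UNIV. of_int (c j) *\<^sub>R q j)" "v = (\<Sum>j\<in>UNIV. of_int (d j) *\<^sub>R q j)"
    unfolding int_span_def by blast
  then have "u + v = (\<Sum>j\<in>UNIV. of_int (c j + d j) *\<^sub>R q j)"
    by (simp add: scaleR_add_left sum.distrib)
  then show ?thesis by (simp only: int_spanI)
qed

lemma int_span_scale: "u \<in> int_span q \<Longrightarrow> of_int k *\<^sub>R u \<in> int_span q"
proof -
  assume "u \<in> int_span q"
  then obtain c where "u = (\<Sum>j\<in>UNIV. of_int (c j) *\<^sub>R q j)"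
    unfolding int_span_def by blast
  then have "of_int k *\<^sub>R u = (\<Sum>j\<in>UNIV. of_int (k * c j) *\<^sub>R q j)"
    by (simp add: scaleR_sum_right)
  then show ?thesis by (simp only: int_spanI)
qed

lemma int_span_zero: "0 \<in> int_span q"
  using int_spanI[of "\<lambda>_. 0" q] by simp

lemma int_span_base: "q j \<in> int_span q"
proof -
  have "(\<Sum>i\<in>UNIV. of_int (of_bool (i = j)) *\<^sub>R q i) = (\<Sum>i\<in>UNIV. if i = j then q i else 0)"
    by (rule sum.cong) auto
  then have "q j = (\<Sum>i\<in>UNIV. of_int (of_bool (i = j)) *\<^sub>R q i)" by simp
  also have "\<dots> \<in> int_span q" by (rule int_spanI)
  finally show ?thesis .
qed

lemma int_span_sum: "(\<And>i. i \<in> I \<Longrightarrow> f i \<in> int_span q) \<Longrightarrow> sum f I \<in> int_span q"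
  by (induction I rule: infinite_finite_induct) (auto intro: int_span_zero int_span_add)

lemma image_int_span:
  assumes "linear f" shows "f ` int_span q = int_span (f \<circ> q)"
  unfolding int_span_def image_image
  by (simp add: linear_sum[OF assms] linear_cmul[OF assms])

section \<open>Forms and weights invariant under reflections\<close>

definition reflect :: "'a::real_inner \<Rightarrow> 'a \<Rightarrow> 'a" where
  "reflect r u = u - (2 * (u \<bullet> r) / (r \<bullet> r)) *\<^sub>R r"

lemma inner_reflect: "reflect r u \<bullet> reflect r v = u \<bullet> v"
proof (cases "r = 0")
  case False
  then have "r \<bullet> r \<noteq> 0" by simp
  then show ?thesis
    by (simp add: reflect_def inner_diff_left inner_diff_right inner_commute field_simps)
qed (simp add: reflect_def)

lemma norm_reflect: "norm (reflect r u) = norm u"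
  by (simp add: norm_eq_sqrt_inner inner_reflect)

lemma reflect_reflect: "reflect r (reflect r u) = u"
proof (cases "r = 0")
  case False
  then have "r \<bullet> r \<noteq> 0" by simp
  then show ?thesis by (simp add: reflect_def inner_diff_left algebra_simps)
qed (simp add: reflect_def)

text \<open>Reflection in \<open>r a\<close> negates \<open>r a\<close> and fixes its orthogonal complement, so invariance
  makes \<open>r a\<close> an eigenvector of \<open>M\<close>. By symmetry of \<open>M\<close>, two eigenvectors that are not orthogonal
  have the same eigenvalue. This is an elementary form of Schur's lemma for the irreducible
  group generated by the reflections.\<close>

lemma invariant_form_scalar:
  fixes M :: "'a::real_inner \<Rightarrow> 'a \<Rightarrow> 'b::real_vector" and r :: "'i \<Rightarrow> 'a"
  assumes M: "bilinear M" and sym: "\<And>u v. M u v = M v u"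
    and inv: "\<And>a u v. M (reflect (r a) u) (reflect (r a) v) = M u v"
    and conn: "\<And>a b. r a \<bullet> r b \<noteq> 0"
    and span: "span (range r) = UNIV"
  obtains c where "\<And>u v. M u v = (u \<bullet> v) *\<^sub>R c"
proof -
  define m where "m a = (1 / (r a \<bullet> r a)) *\<^sub>R M (r a) (r a)" for a
  have eigen: "M u (r a) = (u \<bullet> r a) *\<^sub>R m a" for u a
  proof -
    let ?t = "2 * (u \<bullet> r a) / (r a \<bullet> r a)"
    have "reflect (r a) (r a) = - r a"
      using conn[of a a] by (simp add: reflect_def scaleR_2)
    then have "M u (r a) = M (u - ?t *\<^sub>R r a) (- r a)"
      using inv[of a u "r a"] by (simp add: reflect_def)
    also have "\<dots> = - M u (r a) + ?t *\<^sub>R M (r a) (r a)"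
      by (simp add: bilinear_rneg[OF M] bilinear_lsub[OF M] bilinear_lmul[OF M])
    finally have "2 *\<^sub>R M u (r a) = ?t *\<^sub>R M (r a) (r a)"
      by (simp add: scaleR_2 eq_diff_eq)
    then have "(1/2) *\<^sub>R (2 *\<^sub>R M u (r a)) = (1/2) *\<^sub>R (?t *\<^sub>R M (r a) (r a))" by simp
    then show ?thesis by (simp add: m_def)
  qed
  have same: "m a = m b" for a b
    using sym[of "r a" "r b"] eigen[of "r a" b] eigen[of "r b" a] conn[of a b]
    by (simp add: inner_commute)
  define c where "c = m undefined"
  have c: "M u (r a) = (u \<bullet> r a) *\<^sub>R c" for u a
    unfolding c_def using eigen same by metis
  have "M u v = (u \<bullet> v) *\<^sub>R c" for u v
  proof -
    have "linear (M u)" using M by (simp add: bilinear_def)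
    moreover have "linear (\<lambda>v. (u \<bullet> v) *\<^sub>R c)"
      by (rule linearI) (simp_all add: inner_add_right scaleR_add_left)
    ultimately show ?thesis
      by (rule linear_eq_on_span[where B = "range r"]) (use c span in auto)
  qed
  then show thesis by (rule that)
qed

lemma infsum_finite_sum:
  fixes f :: "'i \<Rightarrow> 'a \<Rightarrow> 'b::{topological_comm_monoid_add,t2_space}"
  assumes "finite I" "\<And>i. i \<in> I \<Longrightarrow> f i summable_on A"
  shows "(\<Sum>\<^sub>\<infinity>x\<in>A. \<Sum>i\<in>I. f i x) = (\<Sum>i\<in>I. infsum (f i) A)"
    and "(\<lambda>x. \<Sum>i\<in>I. f i x) summable_on A"
proof -
  have "((\<lambda>x. \<Sum>i\<in>I. f i x) has_sum (\<Sum>i\<in>I. infsum (f i) A)) A"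
    using assms by (induction I rule: finite_induct) (auto intro!: has_sum_add)
  then show "(\<Sum>\<^sub>\<infinity>x\<in>A. \<Sum>i\<in>I. f i x) = (\<Sum>i\<in>I. infsum (f i) A)"
    and "(\<lambda>x. \<Sum>i\<in>I. f i x) summable_on A"
    by (auto simp: infsumI summable_on_def)
qed

text \<open>The second moment \<open>M u v = \<Sum>\<^sub>\<infinity>\<gamma>. (\<gamma> \<bullet> u) (\<gamma> \<bullet> v) w \<gamma>\<close> is an invariant form, hence a scalar
  multiple of the inner product, and its trace \<open>\<Sum>\<^sub>\<infinity>\<gamma>. \<parallel>\<gamma>\<parallel>\<^sup>2 w \<gamma>\<close> determines the scalar. This is the weighted
  version of the fact that every finite orbit of the reflection group on a sphere is a spherical
  2-design; using the weight avoids a decomposition into shells.\<close>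

lemma weighted_second_moment:
  fixes L :: "'a::euclidean_space set" and w :: "'a \<Rightarrow> complex" and r :: "'i \<Rightarrow> 'a"
  assumes summable: "(\<lambda>\<gamma>. (norm \<gamma>)\<^sup>2 * norm (w \<gamma>)) summable_on L"
    and lattice: "\<And>a \<gamma>. \<gamma> \<in> L \<Longrightarrow> reflect (r a) \<gamma> \<in> L"
    and weight: "\<And>a \<gamma>. w (reflect (r a) \<gamma>) = w \<gamma>"
    and conn: "\<And>a b. r a \<bullet> r b \<noteq> 0"
    and span: "span (range r) = UNIV"
  shows "(\<Sum>\<^sub>\<infinity>\<gamma>\<in>L. ((\<gamma> \<bullet> \<delta>)\<^sup>2 - (norm \<gamma>)\<^sup>2 * (norm \<delta>)\<^sup>2 / DIM('a)) *\<^sub>R w \<gamma>) = 0"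
proof -
  define f where "f u v = (\<lambda>\<gamma>. ((\<gamma> \<bullet> u) * (\<gamma> \<bullet> v)) *\<^sub>R w \<gamma>)" for u v
  define M where "M u v = infsum (f u v) L" for u v
  have f: "f u v summable_on L" for u v
  proof (rule abs_summable_summable, rule Infinite_Sum.abs_summable_on_comparison_test')
    show "(\<lambda>\<gamma>. (norm u * norm v) * ((norm \<gamma>)\<^sup>2 * norm (w \<gamma>))) summable_on L"
      by (rule summable_on_cmult_right[OF summable])
    fix \<gamma>
    have "\<bar>\<gamma> \<bullet> u\<bar> * \<bar>\<gamma> \<bullet> v\<bar> \<le> (norm \<gamma> * norm u) * (norm \<gamma> * norm v)"
      by (intro mult_mono Cauchy_Schwarz_ineq2) auto
    then have "\<bar>\<gamma> \<bullet> u\<bar> * \<bar>\<gamma> \<bullet> v\<bar> * norm (w \<gamma>)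
        \<le> (norm \<gamma> * norm u) * (norm \<gamma> * norm v) * norm (w \<gamma>)"
      by (rule mult_right_mono) simp
    then show "norm (f u v \<gamma>) \<le> norm u * norm v * ((norm \<gamma>)\<^sup>2 * norm (w \<gamma>))"
      by (simp add: f_def abs_mult power2_eq_square mult_ac)
  qed
  have sym: "M u v = M v u" for u v
    by (simp add: M_def f_def mult.commute)
  have lin: "linear (M u)" for u
  proof (rule linearI)
    fix v v' and c :: real
    have "f u (v + v') = (\<lambda>\<gamma>. f u v \<gamma> + f u v' \<gamma>)"
      by (simp add: f_def inner_add_right algebra_simps)
    then show "M u (v + v') = M u v + M u v'"
      by (simp add: M_def infsum_add f)
    have "f u (c *\<^sub>R v) = (\<lambda>\<gamma>. c *\<^sub>R f u v \<gamma>)"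
      by (simp add: f_def mult_ac)
    then show "M u (c *\<^sub>R v) = c *\<^sub>R M u v"
      by (simp add: M_def infsum_scaleR_right)
  qed
  have "bilinear M"
    unfolding bilinear_def using lin sym by (metis (no_types, lifting) ext)
  moreover have "M (reflect (r a) u) (reflect (r a) v) = M u v" for a u v
  proof -
    have bij: "bij_betw (reflect (r a)) L L"
      by (rule bij_betwI[of _ _ _ "reflect (r a)"]) (auto simp: lattice reflect_reflect)
    have "M (reflect (r a) u) (reflect (r a) v)
        = (\<Sum>\<^sub>\<infinity>\<gamma>\<in>L. f (reflect (r a) u) (reflect (r a) v) (reflect (r a) \<gamma>))"
      unfolding M_def by (rule infsum_reindex_bij_betw[OF bij, symmetric])
    then show ?thesis by (simp add: M_def f_def inner_reflect weight)
  qed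
  ultimately obtain c where c: "\<And>u v. M u v = (u \<bullet> v) *\<^sub>R c"
    using invariant_form_scalar[of M r] sym conn span by blast
  \<comment> \<open>Parseval: the trace of \<open>M\<close> is the weighted sum of squared norms.\<close>
  have trace: "(norm \<gamma>)\<^sup>2 *\<^sub>R w \<gamma> = (\<Sum>b\<in>Basis. f b b \<gamma>)" for \<gamma>
    unfolding power2_norm_eq_inner
    by (subst euclidean_inner) (simp add: f_def scaleR_sum_left)
  have "(\<Sum>\<^sub>\<infinity>\<gamma>\<in>L. (norm \<gamma>)\<^sup>2 *\<^sub>R w \<gamma>) = (\<Sum>b\<in>(Basis::'a set). M b b)"
    unfolding trace M_def by (rule infsum_finite_sum) (auto intro: f)
  also have "\<dots> = DIM('a) *\<^sub>R c" by (simp add: c scaleR_conv_of_real)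
  finally have tr: "(\<Sum>\<^sub>\<infinity>\<gamma>\<in>L. (norm \<gamma>)\<^sup>2 *\<^sub>R w \<gamma>) = DIM('a) *\<^sub>R c" .
  have n: "(\<lambda>\<gamma>. (norm \<gamma>)\<^sup>2 *\<^sub>R w \<gamma>) summable_on L"
    unfolding trace by (rule infsum_finite_sum) (auto intro: f)
  have "((\<gamma> \<bullet> \<delta>)\<^sup>2 - (norm \<gamma>)\<^sup>2 * (norm \<delta>)\<^sup>2 / DIM('a)) *\<^sub>R w \<gamma>
      = f \<delta> \<delta> \<gamma> + (- ((norm \<delta>)\<^sup>2 / DIM('a))) *\<^sub>R ((norm \<gamma>)\<^sup>2 *\<^sub>R w \<gamma>)" for \<gamma>
    by (simp add: f_def power2_eq_square algebra_simps)
  then have "(\<Sum>\<^sub>\<infinity>\<gamma>\<in>L. ((\<gamma> \<bullet> \<delta>)\<^sup>2 - (norm \<gamma>)\<^sup>2 * (norm \<delta>)\<^sup>2 / DIM('a)) *\<^sub>R w \<gamma>)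
      = M \<delta> \<delta> + (- ((norm \<delta>)\<^sup>2 / DIM('a))) *\<^sub>R (\<Sum>\<^sub>\<infinity>\<gamma>\<in>L. (norm \<gamma>)\<^sup>2 *\<^sub>R w \<gamma>)"
    by (simp only: infsum_add[OF f summable_on_scaleR_right[OF n]] M_def infsum_scaleR_right)
  also have "\<dots> = 0"
    unfolding tr c by (simp add: power2_norm_eq_inner)
  finally show ?thesis .
qed

section \<open>Reflections of a simplex lattice\<close>

text \<open>The difference of the vertex \<open>q a\<close> and the vertex \<open>- (\<Sum>j. q j)\<close>. The reflection in it is
  the transposition of these two vertices, and together these transpositions generate the
  symmetric group of the simplex.\<close>

definition frame_root :: "('n::finite \<Rightarrow> 'a::real_vector) \<Rightarrow> 'n \<Rightarrow> 'a" where
  "frame_root q a = q a + (\<Sum>j\<in>UNIV. q j)"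

text \<open>Up to a factor, the roots are the basis dual to the frame. That no
  two of them are orthogonal is what \<open>invariant_form_scalar\<close> requires.\<close>

lemma inner_frame_root:
  fixes q :: "'n::finite \<Rightarrow> 'a::real_inner"
  assumes "simplex_frame q"
  shows "q j \<bullet> frame_root q a = (real CARD('n) + 1) / 2 * of_bool (j = a)"
  using inner_combination_frame[OF assms, of "\<lambda>_. 1" j]
  by (simp add: frame_root_def inner_add_right inner_commute simplex_frame_inner[OF assms] field_simps)

lemma inner_frame_roots:
  fixes q :: "'n::finite \<Rightarrow> 'a::real_inner"
  assumes "simplex_frame q"
  shows "frame_root q a \<bullet> frame_root q b = (real CARD('n) + 1) / 2 * (1 + of_bool (a = b))"
proof -
  have "frame_root q a \<bullet> frame_root q b
      = q a \<bullet> frame_root q b + (\<Sum>j\<in>UNIV. q j \<bullet> frame_root q b)"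
    by (simp add: frame_root_def[of q a] inner_add_left inner_sum_left)
  also have "(\<Sum>j\<in>UNIV. q j \<bullet> frame_root q b)
      = (\<Sum>j\<in>UNIV. if j = b then (real CARD('n) + 1) / 2 else 0)"
    by (rule sum.cong) (auto simp: inner_frame_root[OF assms])
  also have "q a \<bullet> frame_root q b + \<dots> = (real CARD('n) + 1) / 2 * (1 + of_bool (a = b))"
    by (simp add: inner_frame_root[OF assms] field_simps)
  finally show ?thesis .
qed

lemma span_frame_root:
  fixes q :: "'n::finite \<Rightarrow> 'a::euclidean_space"
  assumes "simplex_frame q" and "DIM('a) = CARD('n)"
  shows "span (range (frame_root q)) = UNIV"
proof -
  have "(\<Sum>a\<in>UNIV. frame_root q a) = (1 + real CARD('n)) *\<^sub>R (\<Sum>j\<in>UNIV. q j)"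
    by (simp add: frame_root_def sum.distrib scaleR_add_left sum_constant_scaleR)
  then have "q a = frame_root q a - (1 / (1 + real CARD('n))) *\<^sub>R (\<Sum>b\<in>UNIV. frame_root q b)" for a
    by (simp add: frame_root_def[of q a] add_nonneg_eq_0_iff)
  then have "range q \<subseteq> span (range (frame_root q))"
    by (auto intro!: span_diff span_scale span_sum intro: span_base)
  then have "span (range q) \<subseteq> span (range (frame_root q))"
    by (simp add: span_minimal)
  with span_simplex_frame[OF assms] show ?thesis by auto
qed

text \<open>By duality the reflection in the root of index \<open>a\<close> subtracts the \<open>a\<close>-th coordinate times
  that root, which keeps coordinates integral.\<close>

lemma reflect_int_span:
  fixes q :: "'n::finite \<Rightarrow> 'a::real_inner"
  assumes "simplex_frame q" and "\<gamma> \<in> int_span q"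
  shows "reflect (frame_root q a) \<gamma> \<in> int_span q"
proof -
  obtain c where c: "\<gamma> = (\<Sum>j\<in>UNIV. of_int (c j) *\<^sub>R q j)"
    using assms(2) unfolding int_span_def by blast
  have "\<gamma> \<bullet> frame_root q a
    = (\<Sum>j\<in>UNIV. if j = a then of_int (c j) * ((real CARD('n) + 1) / 2) else 0)"
    unfolding c inner_sum_left
    by (rule sum.cong) (auto simp: inner_frame_root[OF assms(1)])
  then have "\<gamma> \<bullet> frame_root q a = of_int (c a) * ((real CARD('n) + 1) / 2)" by simp
  then have "reflect (frame_root q a) \<gamma> = \<gamma> + of_int (- c a) *\<^sub>R frame_root q a"
    by (simp add: reflect_def inner_frame_roots[OF assms(1)] field_simps)
  moreover have "frame_root q a \<in> int_span q"
    unfolding frame_root_def by (intro int_span_add int_span_sum int_span_base)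
  ultimately show ?thesis using assms(2) by (simp only: int_span_add int_span_scale)
qed

section \<open>Convergence of Gaussian sums\<close>

text \<open>Any finite set of functions lies in a finite box, and over a box the sum of products is
  a product of sums.\<close>

lemma summable_on_prod_functions:
  fixes f :: "'b \<Rightarrow> real"
  assumes "f summable_on UNIV" and "\<And>x. f x \<ge> 0"
  shows "(\<lambda>c :: 'n::finite \<Rightarrow> 'b. \<Prod>j\<in>UNIV. f (c j)) summable_on UNIV"
proof (rule nonneg_bdd_above_summable_on)
  show "bdd_above (sum (\<lambda>c :: 'n \<Rightarrow> 'b. \<Prod>j\<in>UNIV. f (c j)) ` {F. F \<subseteq> UNIV \<and> finite F})"
  proof (rule bdd_aboveI2)
    fix F :: "('n \<Rightarrow> 'b) set" assume "F \<in> {F. F \<subseteq> UNIV \<and> finite F}"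
    then have F: "finite F" by simp
    define B where "B = (\<Union>c\<in>F. range c)"
    have B: "finite B" using F by (simp add: B_def)
    have "(\<Sum>c\<in>F. \<Prod>j\<in>UNIV. f (c j)) \<le> (\<Sum>c\<in>PiE (UNIV :: 'n set) (\<lambda>_. B). \<Prod>j\<in>UNIV. f (c j))"
      by (rule sum_mono2) (auto simp: B_def assms(2) prod_nonneg F intro!: finite_PiE)
    also have "\<dots> = (\<Prod>j\<in>(UNIV::'n set). \<Sum>x\<in>B. f x)"
      by (rule prod_sum_PiE[symmetric]) (auto simp: B)
    also have "\<dots> \<le> (\<Prod>j\<in>(UNIV::'n set). infsum f UNIV)"
      using finite_sum_le_infsum[OF assms(1) B] assms(2) by (intro prod_mono) (auto intro: sum_nonneg)
    finally show "(\<Sum>c\<in>F. \<Prod>j\<in>UNIV. f (c j)) \<le> (\<Prod>j\<in>(UNIV::'n set). infsum f UNIV)" .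
  qed
qed (auto intro: prod_nonneg assms)

lemma summable_on_int_gaussian:
  fixes a :: real
  assumes "a > 0"
  shows "(\<lambda>k::int. exp (- a * (of_int k)\<^sup>2)) summable_on UNIV"
proof -
  have nat: "(\<lambda>n::nat. exp (- a * (real n)\<^sup>2)) summable_on UNIV"
  proof (rule summable_on_comparison_test)
    have "summable (\<lambda>n::nat. exp (- a) ^ n)"
      using assms by (intro summable_geometric) simp
    then show "(\<lambda>n::nat. exp (- a) ^ n) summable_on UNIV"
      by (simp add: summable_on_UNIV_nonneg_real_iff)
    fix n :: nat
    \<comment> \<open>Squares dominate, so a geometric series suffices.\<close>
    have "real n \<le> (real n)\<^sup>2"
      by (cases n) (auto simp: power2_eq_square)
    then show "exp (- a * (real n)\<^sup>2) \<le> exp (- a) ^ n"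
      using assms by (simp add: mult.commute flip: exp_of_nat_mult)
  qed auto
  have "(\<lambda>k::int. exp (- a * (of_int k)\<^sup>2)) summable_on range int"
    using nat by (subst summable_on_reindex) (auto simp: o_def)
  moreover have "(\<lambda>k::int. exp (- a * (of_int k)\<^sup>2)) summable_on range (\<lambda>n. - int n)"
    using nat by (subst summable_on_reindex) (auto simp: o_def inj_on_def)
  moreover have "range int \<union> range (\<lambda>n. - int n) = UNIV"
    by (auto intro: int_cases2)
  ultimately show ?thesis using summable_on_union by metis
qed

lemma summable_on_int_span_gaussian:
  fixes q :: "'n::finite \<Rightarrow> 'a::real_inner"
  assumes "simplex_frame q" and "a > 0"
  shows "(\<lambda>\<gamma>. exp (- a * (norm \<gamma>)\<^sup>2)) summable_on int_span q"
proof -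
  let ?v = "\<lambda>c :: 'n \<Rightarrow> int. \<Sum>j\<in>UNIV. of_int (c j) *\<^sub>R q j"
  have "inj ?v"
  proof (rule injI)
    fix c d assume "?v c = ?v d"
    then have "(\<Sum>j\<in>UNIV. (of_int (c j) - of_int (d j)) *\<^sub>R q j) = 0"
      by (simp add: scaleR_diff_left sum_subtractf)
    with norm_combination_ge[OF assms(1), of "\<lambda>j. of_int (c j) - of_int (d j)"]
    have "(\<Sum>j\<in>UNIV. (of_int (c j) - of_int (d j) :: real)\<^sup>2) \<le> 0" by simp
    then have "(\<Sum>j\<in>UNIV. (of_int (c j) - of_int (d j) :: real)\<^sup>2) = 0"
      by (simp add: antisym sum_nonneg)
    then show "c = d" by (simp add: sum_nonneg_eq_0_iff fun_eq_iff)
  qed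
  moreover have "(\<lambda>c. exp (- a * (norm (?v c))\<^sup>2)) summable_on UNIV"
  proof (rule summable_on_comparison_test)
    show "(\<lambda>c :: 'n \<Rightarrow> int. \<Prod>j\<in>UNIV. exp (- (a / 2) * (of_int (c j))\<^sup>2)) summable_on UNIV"
      using assms(2) by (intro summable_on_prod_functions summable_on_int_gaussian) auto
    fix c :: "'n \<Rightarrow> int"
    have "a * ((\<Sum>j\<in>UNIV. (of_int (c j))\<^sup>2) / 2) \<le> a * (norm (?v c))\<^sup>2"
      using assms(2) norm_combination_ge[OF assms(1), of "\<lambda>j. of_int (c j)"]
      by (intro mult_left_mono) auto
    then show "exp (- a * (norm (?v c))\<^sup>2) \<le> (\<Prod>j\<in>UNIV. exp (- (a / 2) * (of_int (c j))\<^sup>2))"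
      by (simp add: exp_sum[symmetric] sum_negf sum_distrib_left sum_divide_distrib)
  qed auto
  ultimately show ?thesis
    unfolding int_span_def by (simp add: summable_on_reindex o_def)
qed

text \<open>Half of the Gaussian absorbs the factor \<open>\<parallel>\<gamma>\<parallel>\<^sup>2\<close>, since \<open>x \<le> exp x\<close>.\<close>

lemma summable_on_int_span_square_gaussian:
  fixes q :: "'n::finite \<Rightarrow> 'a::real_inner"
  assumes "simplex_frame q" and "a > 0"
  shows "(\<lambda>\<gamma>. (norm \<gamma>)\<^sup>2 * exp (- a * (norm \<gamma>)\<^sup>2)) summable_on int_span q"
proof (rule summable_on_comparison_test)
  show "(\<lambda>\<gamma>. (2 / a) * exp (- (a / 2) * (norm \<gamma>)\<^sup>2)) summable_on int_span q"
    using assms by (intro summable_on_cmult_right summable_on_int_span_gaussian) auto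
  fix \<gamma> :: 'a
  let ?t = "(norm \<gamma>)\<^sup>2"
  have "a / 2 * ?t \<le> exp (a / 2 * ?t)"
    using exp_ge_add_one_self[of "a / 2 * ?t"] by linarith
  then have "?t \<le> 2 / a * exp (a / 2 * ?t)"
    using assms(2) by (simp add: field_simps)
  then have "?t * exp (- a * ?t) \<le> 2 / a * exp (a / 2 * ?t) * exp (- a * ?t)"
    by (rule mult_right_mono) simp
  also have "\<dots> = 2 / a * exp (- (a / 2) * ?t)"
    by (simp add: mult.assoc flip: exp_add)
  finally show "?t * exp (- a * ?t) \<le> 2 / a * exp (- (a / 2) * ?t)" .
qed auto

section \<open>Vanishing of the theta series\<close>

definition theta_weight :: "complex \<Rightarrow> 'a::real_normed_vector \<Rightarrow> complex" where
  "theta_weight z \<gamma> = exp (2 * complex_of_real pi * \<i> * complex_of_real ((norm \<gamma>)\<^sup>2) * z)"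

lemma norm_theta_weight: "norm (theta_weight z \<gamma>) = exp (- (2 * pi * Im z) * (norm \<gamma>)\<^sup>2)"
  by (simp add: theta_weight_def norm_exp_eq_Re mult_ac)

text \<open>The term splits so that, for fixed \<open>\<gamma>\<close>, the sum over \<open>\<delta>\<close> is the one evaluated in
  \<open>weighted_second_moment\<close>.\<close>

lemma theta11_term_eq:
  fixes \<gamma> \<delta> :: "real^'n"
  shows "theta11_term z (\<gamma>, \<delta>)
    = (((\<delta> \<bullet> \<gamma>)\<^sup>2 - (norm \<delta>)\<^sup>2 * (norm \<gamma>)\<^sup>2 / CARD('n)) *\<^sub>R theta_weight z \<delta>)
      * (theta_weight z \<gamma> / 2)"
proof -
  have "exp (2 * complex_of_real pi * \<i> * complex_of_real ((norm \<gamma>)\<^sup>2 + (norm \<delta>)\<^sup>2) * z)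
    = theta_weight z \<gamma> * theta_weight z \<delta>"
    by (simp add: theta_weight_def algebra_simps flip: exp_add)
  then show ?thesis
    by (simp add: theta11_term_def scaleR_conv_of_real inner_commute field_simps)
qed

text \<open>Absolute convergence allows the summation over \<open>\<delta>\<close> to be carried out first, and it already
  gives zero for each \<open>\<gamma>\<close>.\<close>

lemma theta11_int_span:
  fixes q :: "'n::finite \<Rightarrow> real^'n"
  assumes q: "simplex_frame q" and z: "Im z > 0"
  shows "theta11_term z summable_on int_span q \<times> int_span q" and "Theta11 (int_span q) z = 0"
proof -
  let ?L = "int_span q"
  define g :: "real^'n \<Rightarrow> real" where "g \<gamma> = (norm \<gamma>)\<^sup>2 * norm (theta_weight z \<gamma>)" for \<gamma>
  have g: "g summable_on ?L"
    unfolding g_def norm_theta_weight using z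
    by (intro summable_on_int_span_square_gaussian q) auto
  have g0: "g \<gamma> \<ge> 0" for \<gamma> by (simp add: g_def)
  show sm: "theta11_term z summable_on ?L \<times> ?L"
  proof (rule abs_summable_summable, rule Infinite_Sum.abs_summable_on_comparison_test')
    show "(\<lambda>(\<gamma>, \<delta>). g \<gamma> * g \<delta>) summable_on ?L \<times> ?L"
    proof (rule summable_on_SigmaI)
      show "((\<lambda>\<delta>. case (\<gamma>, \<delta>) of (\<gamma>, \<delta>) \<Rightarrow> g \<gamma> * g \<delta>) has_sum g \<gamma> * infsum g ?L) ?L" for \<gamma>
        using g by (auto intro: has_sum_cmult_right)
      show "(\<lambda>\<gamma>. g \<gamma> * infsum g ?L) summable_on ?L"
        using g by (rule summable_on_cmult_left)
    qed (auto simp: g0)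
    show "norm (theta11_term z x) \<le> (case x of (\<gamma>, \<delta>) \<Rightarrow> g \<gamma> * g \<delta>)" for x
    proof (cases x)
      case (Pair \<gamma> \<delta>)
      let ?P = "(norm \<delta>)\<^sup>2 * (norm \<gamma>)\<^sup>2"
      have "(\<delta> \<bullet> \<gamma>)\<^sup>2 \<le> ?P"
        using Cauchy_Schwarz_ineq[of \<delta> \<gamma>] by (simp add: power2_norm_eq_inner)
      moreover have "?P / CARD('n) \<le> ?P / 1"
        by (rule divide_left_mono) auto
      moreover have "0 \<le> ?P / CARD('n)" "0 \<le> (\<delta> \<bullet> \<gamma>)\<^sup>2" "0 \<le> ?P" by simp_all
      ultimately have "\<bar>(\<delta> \<bullet> \<gamma>)\<^sup>2 - ?P / CARD('n)\<bar> \<le> 2 * ?P" by linarith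
      then have "\<bar>(\<delta> \<bullet> \<gamma>)\<^sup>2 - ?P / CARD('n)\<bar> * (norm (theta_weight z \<delta>) * norm (theta_weight z \<gamma>) / 2)
          \<le> 2 * ?P * (norm (theta_weight z \<delta>) * norm (theta_weight z \<gamma>) / 2)"
        by (rule mult_right_mono) simp
      then show ?thesis
        by (simp add: Pair theta11_term_eq norm_mult norm_divide g_def mult_ac)
    qed
  qed
  have "(\<Sum>\<^sub>\<infinity>\<delta>\<in>?L. theta11_term z (\<gamma>, \<delta>)) = 0" for \<gamma>
  proof -
    have "(\<Sum>\<^sub>\<infinity>\<delta>\<in>?L. ((\<delta> \<bullet> \<gamma>)\<^sup>2 - (norm \<delta>)\<^sup>2 * (norm \<gamma>)\<^sup>2 / DIM(real^'n)) *\<^sub>R theta_weight z \<delta>) = 0"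
    proof (rule weighted_second_moment[where r = "frame_root q"])
      show "frame_root q a \<bullet> frame_root q b \<noteq> 0" for a b
        by (simp add: inner_frame_roots[OF q])
    qed (use g q in \<open>auto simp: g_def[abs_def] reflect_int_span theta_weight_def norm_reflect span_frame_root\<close>)
    then show ?thesis unfolding theta11_term_eq infsum_cmult_left' by simp
  qed
  then show "Theta11 ?L z = 0"
    unfolding Theta11_def using infsum_Sigma_banach[OF sm] by simp
qed

section \<open>The form, the Minkowski embedding and the cyclotomic integers\<close>

text \<open>Equal Gram matrices: the coordinate maps of the two frames pull the two inner products
  back to the same form, so composing one with the inverse of the other is an isometry.\<close>

lemma isometry_of_simplex_frames:
  fixes q :: "'n::finite \<Rightarrow> 'a::euclidean_space" and q' :: "'n \<Rightarrow> 'b::euclidean_space"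
  assumes q: "simplex_frame q" "DIM('a) = CARD('n)" and q': "simplex_frame q'" "DIM('b) = CARD('n)"
  obtains f where "linear f" "bij f" "\<And>u v. f u \<bullet> f v = u \<bullet> v" "f \<circ> q = q'"
proof -
  define S where "S x = (\<Sum>i\<in>UNIV. x $ i *\<^sub>R q i)" for x :: "real^'n"
  define S' where "S' x = (\<Sum>i\<in>UNIV. x $ i *\<^sub>R q' i)" for x :: "real^'n"
  have S: "bij S" "linear S" and S': "bij S'" "linear S'"
    using bij_combination[OF q] bij_combination[OF q'] unfolding S_def[abs_def] S'_def[abs_def]
    by (auto intro!: linearI simp: scaleR_add_left sum.distrib scaleR_sum_right)
  define f where "f = S' \<circ> inv S"
  have fS: "f (S x) = S' x" for x
    using S(1) by (simp add: f_def bij_is_inj)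
  have surj: "\<exists>x. u = S x" for u using bij_is_surj[OF S(1)] by (blast elim: surjE)
  show thesis
  proof (rule that)
    show "linear f"
    proof (rule linearI)
      fix u v :: 'a and c :: real
      obtain x y where "u = S x" "v = S y" using surj by blast
      then show "f (u + v) = f u + f v" "f (c *\<^sub>R u) = c *\<^sub>R f u"
        by (simp_all add: fS linear_add[OF S'(2)] linear_cmul[OF S'(2)]
            flip: linear_add[OF S(2)] linear_cmul[OF S(2)])
    qed
    show "bij f" unfolding f_def using S(1) S'(1) by (intro bij_comp bij_imp_bij_inv)
    show "f u \<bullet> f v = u \<bullet> v" for u v
    proof -
      obtain x y where "u = S x" "v = S y" using surj by blast
      then show ?thesis
        unfolding \<open>u = S x\<close> \<open>v = S y\<close> fS
        by (simp add: S_def S'_def inner_combinations[OF q(1)] inner_combinations[OF q'(1)])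
    qed
    show "f \<circ> q = q'"
    proof
      fix i
      have "S (axis i 1) = (\<Sum>j\<in>UNIV. if j = i then q j else 0)"
        unfolding S_def by (rule sum.cong) (auto simp: axis_def)
      moreover have "S' (axis i 1) = (\<Sum>j\<in>UNIV. if j = i then q' j else 0)"
        unfolding S'_def by (rule sum.cong) (auto simp: axis_def)
      ultimately show "(f \<circ> q) i = q' i" using fS[of "axis i 1"] by simp
    qed
  qed
qed

lemma corresponds_to_form_A_mat:
  fixes \<Lambda> :: "(real^'n) set"
  assumes "CARD('n) = p - 1"
  shows "corresponds_to_form \<Lambda> (A_mat p :: real^'n^'n)
    \<longleftrightarrow> (\<exists>q :: 'n \<Rightarrow> real^'n. simplex_frame q \<and> \<Lambda> = int_span q)"
proof -
  have p: "real p - 1 = real CARD('n)"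
    using assms zero_less_card_finite[where 'a = 'n] by linarith
  have gram: "A_mat p = transpose Q ** Q \<longleftrightarrow> simplex_frame (\<lambda>j. column j Q)" for Q :: "real^'n^'n"
    unfolding vec_eq_iff simplex_frame_def
    by (simp add: A_mat_def p matrix_matrix_mult_def transpose_def column_def inner_vec_def eq_commute)
  have lattice: "column_lattice Q = int_span (\<lambda>j. column j Q)" for Q :: "real^'n^'n"
    by (simp add: column_lattice_def int_span_def)
  have "\<exists>Q :: real^'n^'n. q = (\<lambda>j. column j Q)" for q :: "'n \<Rightarrow> real^'n"
    by (rule exI[of _ "\<chi> i j. q j $ i"]) (simp add: column_def fun_eq_iff vec_eq_iff)
  then show ?thesis
    unfolding corresponds_to_form_def gram lattice by metis
qed

text \<open>The inner product on \<open>complex^'m\<close> is the real part of the Hermitian one, hence equal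
  to the Minkowski product.\<close>

lemma euclidean_identification_iff:
  fixes f :: "complex^'m \<Rightarrow> real^'n"
  shows "euclidean_identification f \<longleftrightarrow> linear f \<and> bij f \<and> (\<forall>u v. f u \<bullet> f v = u \<bullet> v)"
proof -
  have "minkowski_product u v = complex_of_real (u \<bullet> v)" for u v :: "complex^'m"
  proof -
    have "x * cnj y + cnj x * y = complex_of_real (2 * (x \<bullet> y))" for x y
      by (simp add: complex_eq_iff inner_complex_def)
    then show ?thesis
      by (simp add: minkowski_product_def inner_vec_def flip: of_real_sum sum_distrib_left)
  qed
  then show ?thesis by (simp add: euclidean_identification_def)
qed

text \<open>The nontrivial powers of \<open>\<omega>\<close> come in the \<open>m\<close> conjugate pairs \<open>\<omega> ^ j\<close>,
  \<open>\<omega> ^ (2 * m + 1 - j)\<close>, and all powers, including \<open>\<omega> ^ 0 = 1\<close>, sum to zero.\<close>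

lemma sum_Re_root_of_unity:
  fixes \<omega> :: complex
  assumes "\<omega> ^ (2 * m + 1) = 1" and "\<omega> \<noteq> 1"
  shows "(\<Sum>j=1..m. Re (\<omega> ^ j)) = - 1 / 2"
proof -
  have "norm \<omega> ^ (2 * m + 1) = 1"
    using assms(1) by (metis norm_one norm_power)
  then have norm: "norm \<omega> = 1"
    using power_eq_imp_eq_base[of "norm \<omega>" "2 * m + 1" 1] by simp
  have conj: "\<omega> ^ (2 * m + 1 - j) = cnj (\<omega> ^ j)" if "j \<le> 2 * m + 1" for j
  proof -
    have "\<omega> ^ j * \<omega> ^ (2 * m + 1 - j) = 1"
      using assms(1) that by (simp flip: power_add)
    moreover have "\<omega> ^ j * cnj (\<omega> ^ j) = 1"
      unfolding complex_norm_square[symmetric] by (simp add: norm_power norm)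
    moreover have "\<omega> ^ j \<noteq> 0" using norm by auto
    ultimately show ?thesis by (metis mult_cancel_left)
  qed
  have "(\<Sum>j<2*m+1. \<omega> ^ j) = 0"
    unfolding sum_gp_strict assms(1) using assms(2) by simp
  moreover have "(\<Sum>j<2*m+1. \<omega> ^ j) = (\<Sum>j\<in>insert 0 ({1..m} \<union> {m+1..2*m}). \<omega> ^ j)"
    by (rule sum.cong) auto
  moreover have "\<dots> = 1 + ((\<Sum>j=1..m. \<omega> ^ j) + (\<Sum>j=m+1..2*m. \<omega> ^ j))"
    by (simp add: sum.union_disjoint)
  ultimately have "1 + ((\<Sum>j=1..m. \<omega> ^ j) + (\<Sum>j=m+1..2*m. \<omega> ^ j)) = 0"
    by (simp only:)
  moreover have "(\<Sum>j=m+1..2*m. \<omega> ^ j) = (\<Sum>j=1..m. \<omega> ^ (2 * m + 1 - j))"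
    by (rule sum.reindex_bij_witness[of _ "\<lambda>j. 2*m+1-j" "\<lambda>j. 2*m+1-j"]) auto
  moreover have "\<dots> = (\<Sum>j=1..m. cnj (\<omega> ^ j))"
    by (intro sum.cong refl conj) simp
  ultimately have "Re (1 + ((\<Sum>j=1..m. \<omega> ^ j) + (\<Sum>j=1..m. cnj (\<omega> ^ j)))) = 0" by simp
  then show ?thesis by (simp flip: complex_cnj_power)
qed

lemma zeta_power: "zeta p ^ k = exp (2 * complex_of_real pi * \<i> * of_nat k / of_nat p)"
  by (simp add: zeta_def mult_ac flip: exp_of_nat_mult)

lemma zeta_power_eq_iff:
  assumes "p > 0" shows "zeta p ^ j = zeta p ^ k \<longleftrightarrow> j mod p = k mod p"
  unfolding zeta_power by (rule complex_root_unity_eq) (use assms in simp)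

lemma int_adjoin_zero: "0 \<in> int_adjoin x"
  unfolding int_adjoin_def by (rule range_eqI[of _ _ 0]) simp

lemma int_adjoin_add: "u \<in> int_adjoin x \<Longrightarrow> v \<in> int_adjoin x \<Longrightarrow> u + v \<in> int_adjoin x"
proof -
  assume "u \<in> int_adjoin x" "v \<in> int_adjoin x"
  then obtain q r where "u = poly (map_poly of_int q) x" "v = poly (map_poly of_int r) x"
    unfolding int_adjoin_def by blast
  moreover have "map_poly of_int (q + r) = (map_poly of_int q + map_poly of_int r :: complex poly)"
    by (rule poly_eqI) (simp add: coeff_map_poly)
  ultimately have "u + v = poly (map_poly of_int (q + r)) x" by simp
  then show ?thesis unfolding int_adjoin_def by (rule range_eqI)
qed

lemma int_adjoin_power: "of_int c * x ^ k \<in> int_adjoin x"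
  unfolding int_adjoin_def
  by (rule range_eqI[of _ _ "monom c k"]) (simp add: map_poly_monom poly_monom)

lemma int_adjoin_sum: "(\<And>i. i \<in> I \<Longrightarrow> f i \<in> int_adjoin x) \<Longrightarrow> sum f I \<in> int_adjoin x"
  by (induction I rule: infinite_finite_induct) (auto intro: int_adjoin_zero int_adjoin_add)

text \<open>The powers of \<open>zeta p\<close> are periodic with period \<open>p\<close>, and \<open>zeta p ^ (p - 1)\<close> is minus the
  sum of the lower powers.\<close>

lemma int_adjoin_zeta:
  fixes e :: "'n::finite \<Rightarrow> nat"
  assumes p: "p > 1" and e: "bij_betw e UNIV {..<p - 1}"
  shows "int_adjoin (zeta p) = int_span (\<lambda>j. zeta p ^ e j)"
proof (intro equalityI subsetI)
  let ?L = "int_span (\<lambda>j. zeta p ^ e j)"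
  have small: "zeta p ^ k \<in> ?L" if "k < p - 1" for k
  proof -
    have "k \<in> range e" using bij_betw_imp_surj_on[OF e] that by simp
    then obtain j where "k = e j" by blast
    then show ?thesis using int_span_base[of "\<lambda>j. zeta p ^ e j" j] by simp
  qed
  have power: "zeta p ^ k \<in> ?L" for k
  proof -
    have mod: "zeta p ^ k = zeta p ^ (k mod p)"
      using p by (simp add: zeta_power_eq_iff)
    show ?thesis
    proof (cases "k mod p < p - 1")
      case True
      then show ?thesis using mod small by simp
    next
      case False
      moreover have "k mod p < p" using p by simp
      ultimately have "k mod p = p - 1" by linarith
      have "zeta p \<noteq> 1" "zeta p ^ p = 1"
        using zeta_power_eq_iff[of p 1 0] zeta_power_eq_iff[of p p 0] p by auto
      then have "(\<Sum>j<p. zeta p ^ j) = 0" by (simp add: sum_gp_strict)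
      moreover have "{..<p} = insert (p - 1) {..<p - 1}" using p by auto
      ultimately have "zeta p ^ (p - 1) = of_int (-1) *\<^sub>R (\<Sum>j<p - 1. zeta p ^ j)"
        by (simp add: eq_neg_iff_add_eq_0)
      also have "\<dots> \<in> ?L" by (intro int_span_scale int_span_sum small) simp
      finally show ?thesis using mod \<open>k mod p = p - 1\<close> by simp
    qed
  qed
  fix x assume "x \<in> int_adjoin (zeta p)"
  then obtain q :: "int poly" where "x = poly (map_poly of_int q) (zeta p)"
    unfolding int_adjoin_def by blast
  then have "x = (\<Sum>i\<le>degree (map_poly of_int q :: complex poly). of_int (coeff q i) *\<^sub>R zeta p ^ i)"
    by (simp add: poly_altdef coeff_map_poly scaleR_conv_of_real)
  also have "\<dots> \<in> ?L" by (intro int_span_sum int_span_scale power)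
  finally show "x \<in> ?L" .
next
  fix x assume "x \<in> int_span (\<lambda>j. zeta p ^ e j)"
  then obtain c :: "'n \<Rightarrow> int" where "x = (\<Sum>j\<in>UNIV. of_int (c j) * zeta p ^ e j)"
    unfolding int_span_def by (auto simp: scaleR_conv_of_real)
  then show "x \<in> int_adjoin (zeta p)" by (simp only: int_adjoin_sum int_adjoin_power)
qed

text \<open>Additivity is only given on \<open>int_adjoin (zeta p)\<close>, so every partial sum has to be shown to
  lie there; homogeneity over the integers follows from additivity.\<close>

lemma minkowski_embedding_combination:
  fixes \<iota> :: "complex \<Rightarrow> complex^'m"
  assumes "minkowski_embedding p idx \<iota>" and "finite I"
  shows "\<iota> (\<Sum>i\<in>I. of_int (c i) *\<^sub>R zeta p ^ e i) = (\<Sum>i\<in>I. of_int (c i) *\<^sub>R \<iota> (zeta p ^ e i))"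
proof -
  let ?Z = "int_adjoin (zeta p)"
  have add: "\<iota> (x + y) = \<iota> x + \<iota> y" if "x \<in> ?Z" "y \<in> ?Z" for x y
    using assms that by (simp add: minkowski_embedding_def)
  have zero: "\<iota> 0 = 0" using add[of 0 0] int_adjoin_zero by simp
  have mem: "of_int a * zeta p ^ k \<in> ?Z" for a k by (rule int_adjoin_power)
  have nat: "\<iota> (of_nat n * zeta p ^ k) = of_nat n *\<^sub>R \<iota> (zeta p ^ k)" for n k
  proof (induction n)
    case (Suc n)
    have "\<iota> (of_nat (Suc n) * zeta p ^ k) = \<iota> (zeta p ^ k + of_nat n * zeta p ^ k)"
      by (simp add: algebra_simps)
    also have "\<dots> = \<iota> (zeta p ^ k) + \<iota> (of_nat n * zeta p ^ k)"
      using mem[of 1 k] mem[of "int n" k] by (intro add) auto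
    finally show ?case using Suc by (simp add: scaleR_add_left)
  qed (simp add: zero)
  have int: "\<iota> (of_int a * zeta p ^ k) = of_int a *\<^sub>R \<iota> (zeta p ^ k)" for a k
  proof (cases a rule: int_cases2)
    case (nonneg n)
    then show ?thesis using nat by simp
  next
    case (nonpos n)
    have "\<iota> (of_int (- int n) * zeta p ^ k) + \<iota> (of_nat n * zeta p ^ k) = 0"
      using add[OF mem[of "- int n" k] mem[of "int n" k]] zero by simp
    then show ?thesis unfolding nonpos nat by (simp add: eq_neg_iff_add_eq_0)
  qed
  show ?thesis using assms(2)
  proof (induction I rule: finite_induct)
    case (insert i I)
    have "(\<Sum>i\<in>I. of_int (c i) *\<^sub>R zeta p ^ e i) \<in> ?Z"
      by (rule int_adjoin_sum) (simp add: scaleR_conv_of_real mem)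
    then show ?case using insert add mem int
      by (simp add: scaleR_conv_of_real)
  qed (simp add: zero)
qed

lemma image_minkowski_embedding:
  fixes \<iota> :: "complex \<Rightarrow> complex^'m" and e :: "'n::finite \<Rightarrow> nat"
  assumes "minkowski_embedding p idx \<iota>" and "p > 1" and "bij_betw e UNIV {..<p - 1}"
  shows "\<iota> ` int_adjoin (zeta p) = int_span (\<lambda>j. \<iota> (zeta p ^ e j))"
  unfolding int_adjoin_zeta[OF assms(2,3)] int_span_def image_image
  by (simp add: minkowski_embedding_combination[OF assms(1)])

text \<open>The inner product of the images of \<open>zeta p ^ k\<close> and \<open>zeta p ^ l\<close> is the sum of \<open>Re (\<omega> ^ j)\<close>
  over \<open>1 \<le> j \<le> (p - 1) / 2\<close>, where \<open>\<omega> = zeta p ^ k * cnj (zeta p ^ l)\<close> is a \<open>p\<close>-th root of unity.\<close>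

lemma simplex_frame_minkowski_embedding:
  fixes \<iota> :: "complex \<Rightarrow> complex^'m" and e :: "'n::finite \<Rightarrow> nat"
  assumes \<iota>: "minkowski_embedding p idx \<iota>" and p: "odd p" "p > 1"
    and e: "bij_betw e UNIV {..<p - 1}"
  shows "simplex_frame (\<lambda>j. \<iota> (zeta p ^ e j))"
  unfolding simplex_frame_def
proof (intro allI)
  fix i j :: 'n
  obtain m where m: "p = 2 * m + 1" using p by (elim oddE)
  have n: "CARD('n) = 2 * m" using bij_betw_same_card[OF e] m by simp
  have idx: "bij_betw idx UNIV {1..m}" using \<iota> m by (simp add: minkowski_embedding_def)
  define \<omega> where "\<omega> = zeta p ^ e i * cnj (zeta p ^ e j)"
  have norm: "norm (zeta p) = 1" by (simp add: zeta_def norm_exp_eq_Re)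
  have unit: "zeta p ^ k * cnj (zeta p ^ k) = 1" for k
    unfolding complex_norm_square[symmetric] by (simp add: norm_power norm)
  have "zeta p ^ (idx l * e i) \<bullet> zeta p ^ (idx l * e j) = Re (\<omega> ^ idx l)" for l
    by (simp add: inner_complex_def \<omega>_def power_mult_distrib mult.commute[of "idx l"] power_mult
        flip: complex_cnj_power)
  then have "\<iota> (zeta p ^ e i) \<bullet> \<iota> (zeta p ^ e j) = (\<Sum>l\<in>UNIV. Re (\<omega> ^ idx l))"
    using \<iota> by (simp add: minkowski_embedding_def inner_vec_def)
  also have "\<dots> = (\<Sum>l=1..m. Re (\<omega> ^ l))"
    by (rule sum.reindex_bij_betw[OF idx])
  also have "\<dots> = (if i = j then real CARD('n) / 2 else - 1 / 2)"
  proof (cases "i = j")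
    case True
    then show ?thesis by (simp add: \<omega>_def unit n del: complex_cnj_power)
  next
    case False
    have "zeta p ^ p = 1" using zeta_power_eq_iff[of p p 0] p by simp
    then have "\<omega> ^ p = 1"
      by (simp add: \<omega>_def power_mult_distrib flip: power_mult) (simp add: mult.commute power_mult flip: complex_cnj_power)
    moreover have "\<omega> \<noteq> 1"
    proof
      assume "\<omega> = 1"
      then have "zeta p ^ e i * cnj (zeta p ^ e j) = zeta p ^ e j * cnj (zeta p ^ e j)"
        unfolding \<omega>_def unit .
      then have "zeta p ^ e i = zeta p ^ e j"
        using unit[of "e j"] by (metis mult_cancel_right mult_zero_right zero_neq_one)
      moreover have "e i < p" "e j < p"
        using bij_betwE[OF e, rule_format, of i] bij_betwE[OF e, rule_format, of j] by simp_all
      ultimately have "e i = e j" using p by (simp add: zeta_power_eq_iff)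
      with e False show False by (simp add: bij_betw_def inj_on_def)
    qed
    ultimately show ?thesis using sum_Re_root_of_unity[of \<omega> m] m False by simp
  qed
  finally show "\<iota> (zeta p ^ e i) \<bullet> \<iota> (zeta p ^ e j)
      = (if i = j then real CARD('n) / 2 else - 1 / 2)" .
qed

theorem proposition3p3:
  fixes p :: nat and \<Lambda> :: "(real^'n) set"
  assumes "prime p" and "odd p" and "CARD('n) = p - 1"
  shows "(corresponds_to_form \<Lambda> (A_mat p) \<longrightarrow>
            (\<forall>z. Im z > 0 \<longrightarrow> theta11_term z summable_on \<Lambda> \<times> \<Lambda> \<and> Theta11 \<Lambda> z = 0)) \<and>
         (\<forall>(idx :: 'm::finite \<Rightarrow> nat) \<iota>. minkowski_embedding p idx \<iota> \<longrightarrow>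
            (corresponds_to_form \<Lambda> (A_mat p) \<longleftrightarrow>
             (\<exists>f. euclidean_identification f \<and> \<Lambda> = f ` \<iota> ` int_adjoin (zeta p))))"
proof (intro conjI impI allI)
  have form: "corresponds_to_form \<Lambda> (A_mat p)
      \<longleftrightarrow> (\<exists>q :: 'n \<Rightarrow> real^'n. simplex_frame q \<and> \<Lambda> = int_span q)"
    by (rule corresponds_to_form_A_mat[OF assms(3)])
  {
    fix z :: complex assume "corresponds_to_form \<Lambda> (A_mat p)" and z: "Im z > 0"
    then obtain q :: "'n \<Rightarrow> real^'n" where q: "simplex_frame q" and \<Lambda>: "\<Lambda> = int_span q"
      unfolding form by blast
    show "theta11_term z summable_on \<Lambda> \<times> \<Lambda>" "Theta11 \<Lambda> z = 0"
      unfolding \<Lambda> using theta11_int_span[OF q z] by simp_all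
  }
  fix idx :: "'m \<Rightarrow> nat" and \<iota> assume \<iota>: "minkowski_embedding p idx \<iota>"
  have p: "p > 1" using assms(1) by (rule prime_gt_1_nat)
  obtain e :: "'n \<Rightarrow> nat" where e: "bij_betw e UNIV {..<p - 1}"
    using ex_bij_betw_finite_nat[of "UNIV :: 'n set"] assms(3) by (auto simp: atLeast0LessThan)
  define v where "v j = \<iota> (zeta p ^ e j)" for j
  have v: "simplex_frame v"
    unfolding v_def[abs_def] by (rule simplex_frame_minkowski_embedding[OF \<iota> assms(2) p e])
  have image: "\<iota> ` int_adjoin (zeta p) = int_span v"
    unfolding v_def[abs_def] by (rule image_minkowski_embedding[OF \<iota> p e])
  have "CARD('m) = (p - 1) div 2"
    using \<iota> bij_betw_same_card[of idx UNIV "{1..(p - 1) div 2}"] by (simp add: minkowski_embedding_def)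
  then have dim: "DIM(complex^'m) = CARD('n)"
    using assms(2,3) by simp
  show "corresponds_to_form \<Lambda> (A_mat p) \<longleftrightarrow>
             (\<exists>f. euclidean_identification f \<and> \<Lambda> = f ` \<iota> ` int_adjoin (zeta p))"
    unfolding form image
  proof
    assume "\<exists>q :: 'n \<Rightarrow> real^'n. simplex_frame q \<and> \<Lambda> = int_span q"
    then obtain q :: "'n \<Rightarrow> real^'n" where q: "simplex_frame q" and \<Lambda>: "\<Lambda> = int_span q" by blast
    obtain f where f: "linear f" "bij f" "\<And>u v. f u \<bullet> f v = u \<bullet> v" and fv: "f \<circ> v = q"
      using isometry_of_simplex_frames[OF v dim q] by auto
    then have "euclidean_identification f" by (simp add: euclidean_identification_iff)
    moreover have "\<Lambda> = f ` int_span v" using image_int_span[OF f(1), of v] \<Lambda> fv by simp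
    ultimately show "\<exists>f. euclidean_identification f \<and> \<Lambda> = f ` int_span v" by blast
  next
    assume "\<exists>f :: complex^'m \<Rightarrow> real^'n. euclidean_identification f \<and> \<Lambda> = f ` int_span v"
    then obtain f :: "complex^'m \<Rightarrow> real^'n" where f: "linear f" "\<And>u v. f u \<bullet> f v = u \<bullet> v" and \<Lambda>: "\<Lambda> = f ` int_span v"
      unfolding euclidean_identification_iff by blast
    have "simplex_frame (f \<circ> v)" using v f(2) by (simp add: simplex_frame_def)
    then show "\<exists>q :: 'n \<Rightarrow> real^'n. simplex_frame q \<and> \<Lambda> = int_span q"
      unfolding \<Lambda> image_int_span[OF f(1)] by blast
  qed
qed

end
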